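(* Let $\varepsilon,\delta,\beta,\alpha,\tau\ge0$, $\lambda>1$ and $n\in\mathbb{N}$, $n\ge 1$. Let $M:\mathbb{R}^n\to\mathbb{R}$ be an $(\varepsilon,\delta)$-differentially private (randomized) algorithm such that for every probability distribution $P$ on $\mathbb{R}$ with $\mu(P):=\mathbb{E}_{X\leftarrow P}[X]\in[0,1]$ and $\mathbb{E}_{X\leftarrow P}[|X-\mu(P)|^\lambda]\le1$ the following three conditions hold: $$\left|\mathbb{E}_{X\leftarrow P^n,M}[M(X)]-\mu(P)\right|\le\beta,$$ $$\mathbb{E}_{X\leftarrow P^n,M}\left[|M(X)-\mu(P)|\right]\le\alpha,$$ $$\int_0^\infty\min\left\{\delta,\ \Pr_{X\leftarrow P^n,M}\left[|M(X)-\mu(P)|>x\right]\right\}\,dx\le\alpha\cdot\tau .$$ If $\gamma>0$ satisfies $16\beta\le\gamma\le1/5$, then $$\alpha\ \ge\ \left(32\,n\,\sinh(\varepsilon)\,\gamma^{1/(\lambda-1)}+16\,n\,\tau\,\gamma^{-1}\right)^{-1}.$$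
   Context: A randomized algorithm $M:\mathcal{X}^n\to\mathcal{Y}$ is $(\varepsilon,\delta)$-differentially private, for $\varepsilon,\delta\ge0$, if for all datasets $x,x'\in\mathcal{X}^n$ differing in exactly one coordinate and all measurable $Y\subseteq\mathcal{Y}$, $\Pr[M(x)\in Y]\le e^{\varepsilon}\Pr[M(x')\in Y]+\delta$. $X\leftarrow P^n$ means $X=(X_1,\dots,X_n)$ consists of $n$ i.i.d. samples from $P$; probabilities and expectations subscripted by $X\leftarrow P^n,M$ are over both $X$ and the independent internal randomness of $M$. If the quantity being inverted is $0$, its inverse is read as $+\infty$ (so the conclusion is that no such $M$ exists). *)

theory Defs
  imports "HOL-Probability.Probability"
begin

text \<open>Datasets are points of the product space over the index set \<open>{..<n}\<close>, hence
  functions that are \<open>undefined\<close> outside \<open>{..<n}\<close>. A randomized algorithm is a Markov kernel: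
  \<open>M x\<close> is the law of the output on the dataset \<open>x\<close>, over the internal randomness.\<close>

definition datasets :: "nat \<Rightarrow> 'a measure \<Rightarrow> (nat \<Rightarrow> 'a) measure" where
  "datasets n \<X> = Pi\<^sub>M {..<n} (\<lambda>_. \<X>)"

definition randomized_algorithm ::
    "nat \<Rightarrow> 'a measure \<Rightarrow> 'b measure \<Rightarrow> ((nat \<Rightarrow> 'a) \<Rightarrow> 'b measure) \<Rightarrow> bool" where
  "randomized_algorithm n \<X> \<Y> M \<longleftrightarrow> M \<in> datasets n \<X> \<rightarrow>\<^sub>M prob_algebra \<Y>"

definition neighbouring :: "nat \<Rightarrow> (nat \<Rightarrow> 'a) \<Rightarrow> (nat \<Rightarrow> 'a) \<Rightarrow> bool" where
  "neighbouring n x x' \<longleftrightarrow> (\<exists>!i. i < n \<and> x i \<noteq> x' i)"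

definition differentially_private ::
    "real \<Rightarrow> real \<Rightarrow> nat \<Rightarrow> 'a measure \<Rightarrow> 'b measure \<Rightarrow> ((nat \<Rightarrow> 'a) \<Rightarrow> 'b measure) \<Rightarrow> bool" where
  "differentially_private \<epsilon> \<delta> n \<X> \<Y> M \<longleftrightarrow>
     (\<forall>x \<in> space (datasets n \<X>). \<forall>x' \<in> space (datasets n \<X>). neighbouring n x x' \<longrightarrow>
       (\<forall>Y \<in> sets \<Y>. measure (M x) Y \<le> exp \<epsilon> * measure (M x') Y + \<delta>))"

definition output_law :: "nat \<Rightarrow> 'a measure \<Rightarrow> ((nat \<Rightarrow> 'a) \<Rightarrow> 'b measure) \<Rightarrow> 'b measure" where
  \<comment> \<open>law of \<open>M(X)\<close> for \<open>X\<close> drawn from \<open>P\<^sup>n\<close>, over both \<open>X\<close> and the internal randomness\<close>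
  "output_law n P M = Pi\<^sub>M {..<n} (\<lambda>_. P) \<bind> M"

definition mean :: "real measure \<Rightarrow> real" where
  "mean P = (\<integral>x. x \<partial>P)"

text \<open>The Bochner integral of a non-integrable function is \<open>0\<close>, so integrability is stated
  explicitly. The absolute moment is a nonnegative integral, so the bound \<open>\<le> 1\<close> entails
  that the moment is finite.\<close>

definition admissible :: "real \<Rightarrow> real measure \<Rightarrow> bool" where
  "admissible lam P \<longleftrightarrow> real_distribution P \<and> integrable P (\<lambda>x. x) \<and> mean P \<in> {0..1} \<and>
     (\<integral>\<^sup>+x. ennreal (\<bar>x - mean P\<bar> powr lam) \<partial>P) \<le> 1"

end

theory Submission
  imports Defs
begin

text \<open>This is a fingerprinting argument over the two-point laws \<open>P\<^sub>q\<close>, which put mass \<open>q\<close> on a fixed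
point \<open>v\<close> and mass \<open>1 - q\<close> on \<open>0\<close>. Let \<open>g(q)\<close> be the mean output on \<open>n\<close> samples from
\<open>P\<^sub>q\<close>. Small bias forces \<open>g\<close> to follow the mean \<open>q v\<close>, so on some interval of
parameters \<open>g\<close> has average slope of order \<open>v\<close>. Privacy forbids a large slope.

The slope is a sum of influences. By the product rule (\<open>DERIV_sum_bernoulli_weight\<close>), \<open>g'(q)\<close> is
the sum over the coordinates \<open>i\<close> of the expected change of the output mean when sample \<open>i\<close> is
switched from \<open>0\<close> to \<open>v\<close> and the other samples are drawn from \<open>P\<^sub>q\<close>. The two
datasets are neighbours, so privacy bounds this change.

One switch moves the mean little. If \<open>D\<^sub>0\<close> and \<open>D\<^sub>1\<close> are the output laws before
and after the switch, writing the expectations of the positive and negative parts of \<open>Y - m\<close> as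
integrals of tail probabilities and comparing the tails gives a gap of at most
\<open>2 sinh \<epsilon>\<close> times the \<open>D\<^sub>0\<close>-mean of \<open>\<bar>Y - m\<bar>\<close>, plus the integrals of
\<open>min {\<delta>, Pr [\<bar>Y - m\<bar> > x]}\<close> under both laws (\<open>dp_expectation_gap\<close>). The base law
\<open>D\<^sub>0\<close> is the one whose sample \<open>i\<close> is \<open>0\<close>. That value has probability at least
\<open>1/2\<close>, so averaging the first term over the other samples costs only a factor \<open>2\<close> against the
error \<open>\<alpha>\<close>. The value \<open>v\<close> has probability \<open>q\<close>, hence the tail terms cost a factor
\<open>1/q\<close>. Altogether \<open>g'(q) \<le> n (4 \<alpha> sinh \<epsilon> + \<alpha> \<tau> / q)\<close> (\<open>sensitivity_le\<close>).

The parameters balance these bounds. With \<open>v = \<gamma> powr (- 1 / (\<lambda> - 1))\<close>, the moment condition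
allows means \<open>q v\<close> up to \<open>\<gamma>/2\<close>. Letting \<open>q v\<close> range over \<open>[\<gamma>/4, \<gamma>/2]\<close>, the
mean moves by \<open>\<gamma>/4\<close>, of which the bias can hide at most \<open>2 \<beta> \<le> \<gamma>/8\<close>. So the average
slope is at least \<open>v/2\<close>, while \<open>1/q \<le> 4 v / \<gamma>\<close>. Dividing by \<open>v/2\<close> gives
\<open>1 \<le> n \<alpha> (8 sinh \<epsilon> / v + 8 \<tau> / \<gamma>)\<close>, which has better constants than required.\<close>

section \<open>Bernoulli product weights on subsets\<close>

text \<open>For \<open>S \<subseteq> I\<close> this is the probability that independent \<open>q\<close>-coins on \<open>I\<close> come up heads
exactly on \<open>S\<close>. Only \<open>S \<inter> I\<close> enters, so that deleting \<open>i\<close> from the index set makes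
\<open>S\<close> and \<open>insert i S\<close> indistinguishable.\<close>
definition bernoulli_weight :: "real \<Rightarrow> 'i set \<Rightarrow> 'i set \<Rightarrow> real" where
  "bernoulli_weight q I S = (\<Prod>i\<in>I. if i \<in> S then q else 1 - q)"

lemma bernoulli_weight_nonneg: "0 \<le> q \<Longrightarrow> q \<le> 1 \<Longrightarrow> 0 \<le> bernoulli_weight q I S"
  unfolding bernoulli_weight_def by (intro prod_nonneg) auto

lemma bernoulli_weight_pos: "0 < q \<Longrightarrow> q < 1 \<Longrightarrow> 0 < bernoulli_weight q I S"
  unfolding bernoulli_weight_def by (intro prod_pos) auto

lemma bernoulli_weight_insert:
  assumes "finite A" "i \<notin> A" "T \<subseteq> A"
  shows "bernoulli_weight q (insert i A) (insert i T) = q * bernoulli_weight q A T"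
    and "bernoulli_weight q (insert i A) T = (1 - q) * bernoulli_weight q A T"
proof -
  have "(\<Prod>j\<in>A. if j \<in> insert i T then q else 1 - q) = bernoulli_weight q A T"
    unfolding bernoulli_weight_def using assms by (intro prod.cong) auto
  then show "bernoulli_weight q (insert i A) (insert i T) = q * bernoulli_weight q A T"
    using assms by (simp add: bernoulli_weight_def)
  show "bernoulli_weight q (insert i A) T = (1 - q) * bernoulli_weight q A T"
    using assms by (auto simp: bernoulli_weight_def)
qed

lemma sum_Pow_insert:
  fixes f :: "'i set \<Rightarrow> 'a::comm_monoid_add"
  assumes "finite A" "i \<notin> A"
  shows "(\<Sum>S\<in>Pow (insert i A). f S) = (\<Sum>T\<in>Pow A. f (insert i T) + f T)"
proof -
  have inj: "inj_on (insert i) (Pow A)"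
    using assms(2) by (auto simp: inj_on_def)
  have "(\<Sum>S\<in>Pow (insert i A). f S) = (\<Sum>T\<in>Pow A. f T) + (\<Sum>S\<in>insert i ` Pow A. f S)"
    unfolding Pow_insert by (rule sum.union_disjoint) (use assms in auto)
  also have "(\<Sum>S\<in>insert i ` Pow A. f S) = (\<Sum>T\<in>Pow A. f (insert i T))"
    by (simp add: sum.reindex[OF inj])
  finally show ?thesis by (simp add: sum.distrib add.commute)
qed

text \<open>Conditioning on one coin. This is how averages over all samples are compared with averages in which
sample \<open>i\<close> is prescribed.\<close>

lemma sum_bernoulli_weight_insert:
  assumes "finite A" "i \<notin> A"
  shows "(\<Sum>S\<in>Pow (insert i A). bernoulli_weight q (insert i A) S * G S) =
    (\<Sum>T\<in>Pow A. bernoulli_weight q A T * (q * G (insert i T) + (1 - q) * G T))"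
  unfolding sum_Pow_insert[OF assms]
  by (intro sum.cong refl) (auto simp: bernoulli_weight_insert[OF assms] algebra_simps)

lemma sum_bernoulli_weight:
  assumes "finite A" shows "(\<Sum>S\<in>Pow A. bernoulli_weight q A S) = 1"
  using assms
proof (induction A)
  case empty
  then show ?case by (simp add: bernoulli_weight_def)
next
  case (insert i A)
  have "(\<Sum>S\<in>Pow (insert i A). bernoulli_weight q (insert i A) S * 1) = 1"
    unfolding sum_bernoulli_weight_insert[OF insert(1,2)] using insert by simp
  then show ?case by simp
qed

text \<open>Differentiating the factor of coin \<open>i\<close> gives \<open>1\<close> or \<open>-1\<close> according to whether \<open>i \<in> S\<close>,
and the remaining factors do not see \<open>i\<close>. Pairing \<open>T\<close> with \<open>insert i T\<close> therefore turns
the derivative of an expectation into a sum of expected influences of the single coins.\<close>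

lemma DERIV_sum_bernoulli_weight:
  assumes "finite I"
  shows "((\<lambda>q. \<Sum>S\<in>Pow I. bernoulli_weight q I S * F S) has_real_derivative
    (\<Sum>i\<in>I. \<Sum>T\<in>Pow (I - {i}). bernoulli_weight q (I - {i}) T * (F (insert i T) - F T))) (at q)"
proof -
  have w: "((\<lambda>q. bernoulli_weight q I S) has_real_derivative
      (\<Sum>i\<in>I. (if i \<in> S then 1 else -1) * bernoulli_weight q (I - {i}) S)) (at q)" for S
    unfolding bernoulli_weight_def
    by (rule has_field_derivative_prod) (auto intro!: derivative_eq_intros)
  have split: "(\<Sum>S\<in>Pow I. (if i \<in> S then 1 else -1) * bernoulli_weight q (I - {i}) S * F S) =
      (\<Sum>T\<in>Pow (I - {i}). bernoulli_weight q (I - {i}) T * (F (insert i T) - F T))"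
    if "i \<in> I" for i
  proof -
    have I: "I = insert i (I - {i})" using that by auto
    have "bernoulli_weight q (I - {i}) (insert i T) = bernoulli_weight q (I - {i}) T" for T
      unfolding bernoulli_weight_def by (intro prod.cong) auto
    then show ?thesis
      using assms by (subst (1) I, subst sum_Pow_insert) (auto simp: algebra_simps intro!: sum.cong)
  qed
  have "((\<lambda>q. \<Sum>S\<in>Pow I. bernoulli_weight q I S * F S) has_real_derivative
      (\<Sum>S\<in>Pow I. (\<Sum>i\<in>I. (if i \<in> S then 1 else -1) * bernoulli_weight q (I - {i}) S) * F S)) (at q)"
    by (intro DERIV_sum DERIV_cmult_right w)
  also have "(\<Sum>S\<in>Pow I. (\<Sum>i\<in>I. (if i \<in> S then 1 else -1) * bernoulli_weight q (I - {i}) S) * F S)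
      = (\<Sum>i\<in>I. \<Sum>S\<in>Pow I. (if i \<in> S then 1 else -1) * bernoulli_weight q (I - {i}) S * F S)"
    unfolding sum_distrib_right by (rule sum.swap)
  also have "\<dots> = (\<Sum>i\<in>I. \<Sum>T\<in>Pow (I - {i}).
      bernoulli_weight q (I - {i}) T * (F (insert i T) - F T))"
    using split by simp
  finally show ?thesis .
qed

section \<open>Samples from a two-point law\<close>

definition two_point :: "real \<Rightarrow> real \<Rightarrow> real measure" where
  "two_point q v = distr (measure_pmf (bernoulli_pmf q)) borel (\<lambda>b. if b then v else 0)"

lemma sets_two_point [measurable_cong, simp]: "sets (two_point q v) = sets borel"
  by (simp add: two_point_def)

lemma real_distribution_two_point: "real_distribution (two_point q v)"
  unfolding two_point_def
  by (rule prob_space.real_distribution_distr) (auto intro: prob_space_measure_pmf)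

lemma nn_integral_two_point:
  assumes "0 \<le> q" "q \<le> 1" "h \<in> borel_measurable borel"
  shows "(\<integral>\<^sup>+x. h x \<partial>two_point q v) = ennreal q * h v + ennreal (1 - q) * h 0"
  using assms unfolding two_point_def
  by (subst nn_integral_distr) (auto simp: mult.commute)

lemma integrable_two_point:
  assumes "h \<in> borel_measurable borel"
  shows "integrable (two_point q v) (h :: real \<Rightarrow> real)"
  using assms unfolding two_point_def
  by (subst integrable_distr_eq) (auto intro!: integrable_measure_pmf_finite)

lemma mean_two_point:
  assumes "0 \<le> q" "q \<le> 1"
  shows "mean (two_point q v) = q * v"
  using assms unfolding mean_def two_point_def
  by (subst integral_distr) auto

text \<open>A sample from a two-point law is a vertex of the cube \<open>{0, v}\<^sup>I\<close>, named here by the set of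
coordinates where it equals \<open>v\<close>. It is undefined off \<open>I\<close>, as points of \<open>Pi\<^sub>M I\<close> must be.\<close>
definition corner :: "'i set \<Rightarrow> real \<Rightarrow> 'i set \<Rightarrow> 'i \<Rightarrow> real" where
  "corner I v S = (\<lambda>i\<in>I. if i \<in> S then v else 0)"

text \<open>Expectations over the samples are finite sums, polynomial in \<open>q\<close>. Fubini peels off one coordinate,
whose integral has two terms, and each splits a subset by membership of that coordinate.\<close>

lemma nn_integral_PiM_two_point:
  assumes "finite I" "0 \<le> q" "q \<le> 1"
    and "F \<in> borel_measurable (Pi\<^sub>M I (\<lambda>_. borel))"
  shows "(\<integral>\<^sup>+x. F x \<partial>Pi\<^sub>M I (\<lambda>_. two_point q v)) =
    (\<Sum>S\<in>Pow I. ennreal (bernoulli_weight q I S) * F (corner I v S))"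
  using assms(1,4)
proof (induction I arbitrary: F)
  case empty
  interpret product_sigma_finite "\<lambda>_::'a. two_point q v"
    using real_distribution_two_point
    by (simp add: product_sigma_finite_def prob_space_imp_sigma_finite real_distribution_def)
  show ?case
    by (simp add: nn_integral_empty bernoulli_weight_def corner_def restrict_def)
next
  case (insert i I)
  interpret product_sigma_finite "\<lambda>_::'a. two_point q v"
    using real_distribution_two_point
    by (simp add: product_sigma_finite_def prob_space_imp_sigma_finite real_distribution_def)
  have [measurable]: "F \<in> borel_measurable (Pi\<^sub>M (insert i I) (\<lambda>_. borel))" by fact
  have [measurable]: "F \<in> borel_measurable (Pi\<^sub>M (insert i I) (\<lambda>_. two_point q v))"
    using insert.prems by (simp cong: measurable_cong_sets sets_PiM_cong)
  have upd: "(\<lambda>x. F (x(i := y))) \<in> borel_measurable (Pi\<^sub>M I (\<lambda>_. borel))" for y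
    by measurable
  have corner1: "(corner I v T)(i := v) = corner (insert i I) v (insert i T)" for T
    by (auto simp: corner_def restrict_def fun_eq_iff)
  have corner0: "(corner I v T)(i := 0) = corner (insert i I) v T" if "T \<subseteq> I" for T
    using that insert(2) by (auto simp: corner_def restrict_def fun_eq_iff)
  have inner: "(\<integral>\<^sup>+y. F (x(i := y)) \<partial>two_point q v)
      = ennreal q * F (x(i := v)) + ennreal (1 - q) * F (x(i := 0))"
    if "x \<in> space (Pi\<^sub>M I (\<lambda>_. borel))" for x
    using assms(2,3) that by (intro nn_integral_two_point) measurable
  have "(\<integral>\<^sup>+x. F x \<partial>Pi\<^sub>M (insert i I) (\<lambda>_. two_point q v))
      = (\<integral>\<^sup>+x. (\<integral>\<^sup>+y. F (x(i := y)) \<partial>two_point q v) \<partial>Pi\<^sub>M I (\<lambda>_. two_point q v))"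
    using insert by (intro product_nn_integral_insert) auto
  also have "\<dots> = (\<integral>\<^sup>+x. ennreal q * F (x(i := v)) + ennreal (1 - q) * F (x(i := 0))
      \<partial>Pi\<^sub>M I (\<lambda>_. two_point q v))"
    by (intro nn_integral_cong inner) (auto simp: space_PiM)
  also have "\<dots> = (\<Sum>T\<in>Pow I. ennreal (bernoulli_weight q I T) *
      (ennreal q * F ((corner I v T)(i := v)) + ennreal (1 - q) * F ((corner I v T)(i := 0))))"
    by (intro insert.IH borel_measurable_add borel_measurable_times_ennreal upd borel_measurable_const)
  also have "\<dots> = (\<Sum>S\<in>Pow (insert i I). ennreal (bernoulli_weight q (insert i I) S) *
      F (corner (insert i I) v S))"
    unfolding sum_Pow_insert[OF insert(1,2)]
    using assms(2,3) insert(1,2)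
    by (intro sum.cong refl)
       (auto simp: bernoulli_weight_insert corner1 corner0 ennreal_mult bernoulli_weight_nonneg
          distrib_left mult_ac)
  finally show ?case .
qed

section \<open>Expectations from tail probabilities\<close>

text \<open>Tonelli, applied to the region below the graph of \<open>h\<close>. It brings privacy, which speaks about
probabilities, to bear on expectations.\<close>

lemma nn_integral_layer_cake:
  assumes "prob_space A" "h \<in> borel_measurable A" "\<And>y. 0 \<le> h y"
  shows "(\<integral>\<^sup>+y. ennreal (h y) \<partial>A) =
    (\<integral>\<^sup>+x\<in>{0..}. ennreal (measure A {y \<in> space A. h y > x}) \<partial>lborel)"
proof -
  interpret prob_space A by fact
  interpret pair_sigma_finite A lborel by unfold_locales
  have [measurable]: "h \<in> borel_measurable A" by fact
  have "(\<integral>\<^sup>+y. ennreal (h y) \<partial>A) = (\<integral>\<^sup>+y. (\<integral>\<^sup>+x. indicator {0..<h y} x \<partial>lborel) \<partial>A)"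
    using assms(3) by (auto intro!: nn_integral_cong)
  also have "\<dots> = (\<integral>\<^sup>+y. (\<integral>\<^sup>+x. indicator {0..} x * indicator {y. fst y < h (snd y)} (x, y) \<partial>lborel) \<partial>A)"
    by (intro nn_integral_cong) (auto simp: indicator_def)
  also have "\<dots> = (\<integral>\<^sup>+x. (\<integral>\<^sup>+y. indicator {0..} x * indicator {y. fst y < h (snd y)} (x, y) \<partial>A) \<partial>lborel)"
    by (rule Fubini'[symmetric]) measurable
  also have "\<dots> = (\<integral>\<^sup>+x. indicator {0..} x * emeasure A {y \<in> space A. h y > x} \<partial>lborel)"
  proof (intro nn_integral_cong)
    fix x :: real
    have "(\<integral>\<^sup>+y. indicator {0..} x * indicator {y. fst y < h (snd y)} (x, y) \<partial>A)
      = (\<integral>\<^sup>+y. indicator {0..} x * indicator {y \<in> space A. h y > x} y \<partial>A)"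
      by (intro nn_integral_cong) (auto simp: indicator_def)
    then show "(\<integral>\<^sup>+y. indicator {0..} x * indicator {y. fst y < h (snd y)} (x, y) \<partial>A)
      = indicator {0..} x * emeasure A {y \<in> space A. h y > x}"
      by (simp add: nn_integral_cmult)
  qed
  also have "\<dots> = (\<integral>\<^sup>+x\<in>{0..}. ennreal (measure A {y \<in> space A. h y > x}) \<partial>lborel)"
    by (simp add: emeasure_eq_measure mult.commute)
  finally show ?thesis .
qed

text \<open>The additive slack \<open>\<delta>\<close> in the definition of privacy applies to the event \<open>h > x\<close> at every
level \<open>x\<close>. This is the total it can contribute to the expectation of \<open>h\<close>, as no event gains
more than its own probability.\<close>
definition truncated_tail :: "real \<Rightarrow> 'a measure \<Rightarrow> ('a \<Rightarrow> real) \<Rightarrow> ennreal" where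
  "truncated_tail \<delta> A h =
    (\<integral>\<^sup>+x\<in>{0..}. ennreal (min \<delta> (measure A {y \<in> space A. h y > x})) \<partial>lborel)"

lemma borel_measurable_tail:
  assumes "prob_space A" "h \<in> borel_measurable A"
  shows "(\<lambda>x::real. measure A {y \<in> space A. h y > x}) \<in> borel_measurable borel"
proof -
  interpret prob_space A by fact
  have [measurable]: "h \<in> borel_measurable A" by fact
  have "mono (\<lambda>x::real. - measure A {y \<in> space A. h y > x})"
    by (intro monoI) (auto intro!: finite_measure_mono)
  then have "(\<lambda>x. - (- measure A {y \<in> space A. h y > x})) \<in> borel_measurable borel"
    by (intro borel_measurable_uminus borel_measurable_mono)
  then show ?thesis by simp
qed

lemma truncated_tail_mono:
  assumes "prob_space A" "h \<in> borel_measurable A" "g \<in> borel_measurable A" "\<And>y. h y \<le> g y"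
  shows "truncated_tail \<delta> A h \<le> truncated_tail \<delta> A g"
proof -
  interpret prob_space A by fact
  have [measurable]: "h \<in> borel_measurable A" "g \<in> borel_measurable A" by fact+
  have "measure A {y \<in> space A. h y > x} \<le> measure A {y \<in> space A. g y > x}" for x
    using assms(4) by (intro finite_measure_mono) (auto intro: less_le_trans)
  then show ?thesis
    unfolding truncated_tail_def
    by (intro nn_integral_mono mult_right_mono ennreal_leI min.mono) auto
qed

lemma truncated_tail_le:
  assumes "prob_space A" "integrable A h" "\<And>y. 0 \<le> h y"
  shows "truncated_tail \<delta> A h \<le> ennreal (\<integral>y. h y \<partial>A)"
proof -
  have "truncated_tail \<delta> A h \<le> (\<integral>\<^sup>+y. ennreal (h y) \<partial>A)"
    unfolding truncated_tail_def using assms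
    by (subst nn_integral_layer_cake) (auto intro!: nn_integral_mono mult_right_mono ennreal_leI)
  also have "\<dots> = ennreal (\<integral>y. h y \<partial>A)"
    using assms by (intro nn_integral_eq_integral) auto
  finally show ?thesis .
qed

section \<open>Privacy and expectations\<close>

text \<open>Privacy gives \<open>A{h > x} \<le> e\<^sup>\<epsilon> B{h > x} + \<delta>\<close>. The slack may be lowered to
\<open>min {\<delta>, A{h > x}}\<close>, since when \<open>A{h > x}\<close> is below \<open>\<delta>\<close> it is at most itself. This
keeps the right-hand side integrable in \<open>x\<close>.\<close>

lemma dp_nn_integral_le:
  fixes \<epsilon> \<delta> :: real
  assumes A: "prob_space A" and B: "prob_space B" and sets: "sets A = sets B"
    and h: "h \<in> borel_measurable B" "\<And>y. 0 \<le> h y"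
    and dp: "\<And>Y. Y \<in> sets B \<Longrightarrow> measure A Y \<le> exp \<epsilon> * measure B Y + \<delta>"
    and "0 \<le> \<delta>"
  shows "(\<integral>\<^sup>+y. ennreal (h y) \<partial>A) \<le>
    ennreal (exp \<epsilon>) * (\<integral>\<^sup>+y. ennreal (h y) \<partial>B) + truncated_tail \<delta> A h"
proof -
  have space: "space A = space B" by (rule sets_eq_imp_space_eq) fact
  have hA: "h \<in> borel_measurable A" using h sets by (simp cong: measurable_cong_sets)
  note [measurable] = borel_measurable_tail[OF A hA] borel_measurable_tail[OF B h(1)] hA h(1)
  have le: "measure A {y \<in> space A. h y > x} \<le>
      exp \<epsilon> * measure B {y \<in> space B. h y > x} + min \<delta> (measure A {y \<in> space A. h y > x})" for x
    using dp[of "{y \<in> space B. h y > x}"] by (auto simp: space min_def)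
  have "(\<integral>\<^sup>+y. ennreal (h y) \<partial>A) =
    (\<integral>\<^sup>+x\<in>{0..}. ennreal (measure A {y \<in> space A. h y > x}) \<partial>lborel)"
    by (rule nn_integral_layer_cake[OF A hA h(2)])
  also have "\<dots> \<le> (\<integral>\<^sup>+x. ennreal (exp \<epsilon>) *
        (ennreal (measure B {y \<in> space B. h y > x}) * indicator {0..} x) +
      ennreal (min \<delta> (measure A {y \<in> space A. h y > x})) * indicator {0..} x \<partial>lborel)"
  proof (intro nn_integral_mono)
    fix x :: real
    have "ennreal (measure A {y \<in> space A. h y > x}) \<le>
        ennreal (exp \<epsilon>) * ennreal (measure B {y \<in> space B. h y > x}) +
        ennreal (min \<delta> (measure A {y \<in> space A. h y > x}))"
      using ennreal_leI[OF le[of x]] \<open>0 \<le> \<delta>\<close>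
      by (simp add: ennreal_plus ennreal_mult)
    then show "ennreal (measure A {y \<in> space A. h y > x}) * indicator {0..} x \<le>
        ennreal (exp \<epsilon>) * (ennreal (measure B {y \<in> space B. h y > x}) * indicator {0..} x) +
        ennreal (min \<delta> (measure A {y \<in> space A. h y > x})) * indicator {0..} x"
      by (auto simp: indicator_def)
  qed
  also have "\<dots> = ennreal (exp \<epsilon>) * (\<integral>\<^sup>+y. ennreal (h y) \<partial>B) + truncated_tail \<delta> A h"
    unfolding truncated_tail_def nn_integral_layer_cake[OF B h]
    by (subst nn_integral_add, measurable, subst nn_integral_cmult, measurable)
  finally show ?thesis .
qed

text \<open>The slack is measured by the tail of a dominating \<open>g\<close>, so that the positive and the negative part
of \<open>y - m\<close> can both be charged to \<open>\<bar>y - m\<bar>\<close>, whose tail the accuracy assumptions control.\<close>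

lemma dp_integral_le:
  fixes \<epsilon> \<delta> :: real
  assumes A: "prob_space A" and B: "prob_space B" and sets: "sets A = sets B"
    and h: "integrable B h" "integrable A g" "\<And>y. 0 \<le> h y" "\<And>y. h y \<le> g y"
    and dp: "\<And>Y. Y \<in> sets B \<Longrightarrow> measure A Y \<le> exp \<epsilon> * measure B Y + \<delta>"
    and "0 \<le> \<delta>"
  shows "(\<integral>y. h y \<partial>A) \<le> exp \<epsilon> * (\<integral>y. h y \<partial>B) + enn2real (truncated_tail \<delta> A g)"
proof -
  have hB: "h \<in> borel_measurable B" using h(1) by auto
  have hA: "h \<in> borel_measurable A" using hB sets by (simp cong: measurable_cong_sets)
  have int: "integrable A h"
    using h hA by (intro Bochner_Integration.integrable_bound[OF h(2) hA]) (use h(3) order_trans[OF h(4) abs_ge_self] in auto)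
  have g0: "0 \<le> g y" for y using h(3,4)[of y] by linarith
  have fin: "truncated_tail \<delta> A g = ennreal (enn2real (truncated_tail \<delta> A g))"
    using truncated_tail_le[OF A h(2) g0, of \<delta>]
    by (metis ennreal_enn2real ennreal_less_top le_less_trans)
  have "ennreal (\<integral>y. h y \<partial>A) = (\<integral>\<^sup>+y. ennreal (h y) \<partial>A)"
    using int h(3) by (intro nn_integral_eq_integral[symmetric]) auto
  also have "\<dots> \<le> ennreal (exp \<epsilon>) * (\<integral>\<^sup>+y. ennreal (h y) \<partial>B) + truncated_tail \<delta> A h"
    by (rule dp_nn_integral_le) (use assms hB in auto)
  also have "\<dots> \<le> ennreal (exp \<epsilon>) * (\<integral>\<^sup>+y. ennreal (h y) \<partial>B) + truncated_tail \<delta> A g"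
    by (intro add_left_mono truncated_tail_mono) (use A hA h in auto)
  also have "(\<integral>\<^sup>+y. ennreal (h y) \<partial>B) = ennreal (\<integral>y. h y \<partial>B)"
    using h by (intro nn_integral_eq_integral) auto
  also have "ennreal (exp \<epsilon>) * ennreal (\<integral>y. h y \<partial>B) + truncated_tail \<delta> A g =
      ennreal (exp \<epsilon> * (\<integral>y. h y \<partial>B) + enn2real (truncated_tail \<delta> A g))"
    using h by (subst fin) (simp add: ennreal_plus ennreal_mult integral_nonneg_AE)
  finally show ?thesis
    using h(3) by (subst (asm) ennreal_le_iff) (auto intro!: add_nonneg_nonneg mult_nonneg_nonneg integral_nonneg_AE)
qed

text \<open>Up to the slack terms, the positive part of \<open>y - m\<close> grows by at most the factor \<open>e\<^sup>\<epsilon>\<close> from \<open>D0\<close> to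
\<open>D1\<close>, and the negative part shrinks by at most that factor. Both changes can be measured against
\<open>D0\<close> alone, with coefficients \<open>e\<^sup>\<epsilon> - 1\<close> and \<open>1 - e\<^sup>-\<^sup>\<epsilon>\<close>. Each is at most
\<open>e\<^sup>\<epsilon> - e\<^sup>-\<^sup>\<epsilon> = 2 sinh \<epsilon>\<close>. That only \<open>D0\<close> carries the main term is
essential for \<open>sensitivity_le\<close>.\<close>

lemma dp_expectation_gap:
  fixes D0 D1 :: "real measure" and \<epsilon> \<delta> m :: real
  assumes D0: "prob_space D0" "sets D0 = sets borel" "integrable D0 (\<lambda>y. y)"
    and D1: "prob_space D1" "sets D1 = sets borel" "integrable D1 (\<lambda>y. y)"
    and dp1: "\<And>Y. Y \<in> sets borel \<Longrightarrow> measure D1 Y \<le> exp \<epsilon> * measure D0 Y + \<delta>"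
    and dp0: "\<And>Y. Y \<in> sets borel \<Longrightarrow> measure D0 Y \<le> exp \<epsilon> * measure D1 Y + \<delta>"
    and "0 \<le> \<epsilon>" "0 \<le> \<delta>"
  shows "(\<integral>y. y \<partial>D1) - (\<integral>y. y \<partial>D0) \<le> 2 * sinh \<epsilon> * (\<integral>y. \<bar>y - m\<bar> \<partial>D0) +
    enn2real (truncated_tail \<delta> D1 (\<lambda>y. \<bar>y - m\<bar>)) + enn2real (truncated_tail \<delta> D0 (\<lambda>y. \<bar>y - m\<bar>))"
proof -
  interpret P0: prob_space D0 by fact
  interpret P1: prob_space D1 by fact
  have int: "integrable D0 (\<lambda>y. y - m)" "integrable D1 (\<lambda>y. y - m)"
    "integrable D0 (\<lambda>y. \<bar>y - m\<bar>)" "integrable D1 (\<lambda>y. \<bar>y - m\<bar>)"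
    "integrable D0 (\<lambda>y. max 0 (y - m))" "integrable D1 (\<lambda>y. max 0 (y - m))"
    "integrable D0 (\<lambda>y. max 0 (m - y))" "integrable D1 (\<lambda>y. max 0 (m - y))"
    using D0(3) D1(3) by auto
  define p0 n0 p1 n1 J0 J1 where
    "p0 = (\<integral>y. max 0 (y - m) \<partial>D0)" and "n0 = (\<integral>y. max 0 (m - y) \<partial>D0)" and
    "p1 = (\<integral>y. max 0 (y - m) \<partial>D1)" and "n1 = (\<integral>y. max 0 (m - y) \<partial>D1)" and
    "J0 = enn2real (truncated_tail \<delta> D0 (\<lambda>y. \<bar>y - m\<bar>))" and
    "J1 = enn2real (truncated_tail \<delta> D1 (\<lambda>y. \<bar>y - m\<bar>))"
  note defs = this
  have nonneg: "0 \<le> p0" "0 \<le> n0" "0 \<le> J0"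
    by (auto simp: defs intro!: integral_nonneg_AE)
  have pm: "y - m = max 0 (y - m) - max 0 (m - y)" "\<bar>y - m\<bar> = max 0 (y - m) + max 0 (m - y)" for y :: real
    by auto
  have e0: "(\<integral>y. y \<partial>D0) - m = p0 - n0" and a0: "(\<integral>y. \<bar>y - m\<bar> \<partial>D0) = p0 + n0"
  proof -
    have "(\<integral>y. y \<partial>D0) - m = (\<integral>y. y - m \<partial>D0)"
      using D0(3) by (simp add: P0.prob_space)
    also have "\<dots> = p0 - n0"
      unfolding defs using int by (subst pm(1)) (rule Bochner_Integration.integral_diff)
    finally show "(\<integral>y. y \<partial>D0) - m = p0 - n0" .
    show "(\<integral>y. \<bar>y - m\<bar> \<partial>D0) = p0 + n0"
      unfolding defs using int by (subst pm(2)) (rule Bochner_Integration.integral_add)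
  qed
  have e1: "(\<integral>y. y \<partial>D1) - m = p1 - n1"
  proof -
    have "(\<integral>y. y \<partial>D1) - m = (\<integral>y. y - m \<partial>D1)"
      using D1(3) by (simp add: P1.prob_space)
    also have "\<dots> = p1 - n1"
      unfolding defs using int by (subst pm(1)) (rule Bochner_Integration.integral_diff)
    finally show ?thesis .
  qed
  have "p1 \<le> exp \<epsilon> * p0 + J1"
    unfolding defs by (rule dp_integral_le) (use assms int in auto)
  moreover have "n0 \<le> exp \<epsilon> * n1 + J0"
    unfolding defs by (rule dp_integral_le) (use assms int in auto)
  \<comment> \<open>Solving for \<open>n1\<close> expresses the loss of negative part through \<open>n0\<close>, a quantity of \<open>D0\<close>.\<close>
  then have "exp (-\<epsilon>) * n0 \<le> exp (-\<epsilon>) * (exp \<epsilon> * n1 + J0)"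
    by (intro mult_left_mono) auto
  then have "exp (-\<epsilon>) * n0 \<le> n1 + exp (-\<epsilon>) * J0"
    by (simp add: algebra_simps exp_minus)
  moreover have "exp (-\<epsilon>) * J0 \<le> 1 * J0"
    using nonneg \<open>0 \<le> \<epsilon>\<close> by (intro mult_right_mono) auto
  moreover have "exp (-\<epsilon>) * p0 \<le> 1 * p0" "1 * n0 \<le> exp \<epsilon> * n0"
    using nonneg \<open>0 \<le> \<epsilon>\<close> by (intro mult_right_mono; simp)+
  moreover have sinh: "2 * sinh \<epsilon> = exp \<epsilon> - exp (-\<epsilon>)"
    by (simp add: sinh_def)
  ultimately show ?thesis
    unfolding a0 defs(5,6)[symmetric] sinh using e0 e1 by (simp add: algebra_simps)
qed

section \<open>Output laws over two-point samples\<close>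

lemma corner_in_space: "corner {..<n} v S \<in> space (datasets n borel)"
  by (auto simp: datasets_def space_PiM corner_def)

lemma prob_space_kernel:
  assumes "randomized_algorithm n X Y M" "x \<in> space (datasets n X)"
  shows "prob_space (M x)" "sets (M x) = sets Y"
  using measurable_space[OF assms[unfolded randomized_algorithm_def]]
  by (auto simp: space_prob_algebra)

lemma kernel_measurable_two_point:
  assumes "randomized_algorithm n borel Y M"
  shows "M \<in> Pi\<^sub>M {..<n} (\<lambda>_. two_point q v) \<rightarrow>\<^sub>M prob_algebra Y"
  using assms unfolding randomized_algorithm_def datasets_def
  by (simp cong: measurable_cong_sets sets_PiM_cong)

lemma output_law_two_point:
  assumes "randomized_algorithm n borel Y M"
  shows "prob_space (output_law n (two_point q v) M)"
    and "sets (output_law n (two_point q v) M) = sets Y"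
proof -
  have P: "Pi\<^sub>M {..<n} (\<lambda>_. two_point q v) \<in> space (prob_algebra (Pi\<^sub>M {..<n} (\<lambda>_. two_point q v)))"
    using real_distribution_two_point
    by (auto simp: space_prob_algebra real_distribution_def intro!: prob_space_PiM)
  show "prob_space (output_law n (two_point q v) M)"
    "sets (output_law n (two_point q v) M) = sets Y"
    unfolding output_law_def
    by (rule prob_space_bind'[OF P kernel_measurable_two_point[OF assms]]
      sets_bind'[OF P kernel_measurable_two_point[OF assms]])+
qed

lemma nn_integral_output_law_two_point:
  assumes M: "randomized_algorithm n borel Y M" and q: "0 \<le> q" "q \<le> 1"
    and h: "h \<in> borel_measurable Y"
  shows "(\<integral>\<^sup>+y. h y \<partial>output_law n (two_point q v) M) =
    (\<Sum>S\<in>Pow {..<n}. ennreal (bernoulli_weight q {..<n} S) * (\<integral>\<^sup>+y. h y \<partial>M (corner {..<n} v S)))"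
proof -
  have "(\<integral>\<^sup>+y. h y \<partial>output_law n (two_point q v) M) =
      (\<integral>\<^sup>+x. \<integral>\<^sup>+y. h y \<partial>M x \<partial>Pi\<^sub>M {..<n} (\<lambda>_. two_point q v))"
    unfolding output_law_def
    by (rule nn_integral_bind[OF h measurable_prob_algebraD[OF kernel_measurable_two_point[OF M]]])
  also have "\<dots> = (\<Sum>S\<in>Pow {..<n}. ennreal (bernoulli_weight q {..<n} S) *
      (\<integral>\<^sup>+y. h y \<partial>M (corner {..<n} v S)))"
  proof (rule nn_integral_PiM_two_point)
    have "M \<in> Pi\<^sub>M {..<n} (\<lambda>_. borel) \<rightarrow>\<^sub>M subprob_algebra Y"
      using M unfolding randomized_algorithm_def datasets_def by (rule measurable_prob_algebraD)
    then show "(\<lambda>x. \<integral>\<^sup>+y. h y \<partial>M x) \<in> borel_measurable (Pi\<^sub>M {..<n} (\<lambda>_. borel))"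
      by (rule measurable_compose[OF _ nn_integral_measurable_subprob_algebra[OF h]])
  qed (use q in auto)
  finally show ?thesis .
qed

lemma integral_output_law_two_point:
  fixes h :: "'b \<Rightarrow> real"
  assumes M: "randomized_algorithm n borel Y M" and q: "0 \<le> q" "q \<le> 1"
    and h: "\<And>S. S \<subseteq> {..<n} \<Longrightarrow> integrable (M (corner {..<n} v S)) h"
  shows "(\<integral>y. h y \<partial>output_law n (two_point q v) M) =
    (\<Sum>S\<in>Pow {..<n}. bernoulli_weight q {..<n} S * (\<integral>y. h y \<partial>M (corner {..<n} v S)))"
proof -
  let ?L = "output_law n (two_point q v) M" and ?K = "\<lambda>S. M (corner {..<n} v S)"
  have setsK: "sets (?K S) = sets Y" for S
    by (rule prob_space_kernel(2)[OF M corner_in_space])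
  have nonneg: "has_bochner_integral ?L f
      (\<Sum>S\<in>Pow {..<n}. bernoulli_weight q {..<n} S * (\<integral>y. f y \<partial>?K S))"
    if f: "\<And>S. S \<subseteq> {..<n} \<Longrightarrow> integrable (?K S) f" "\<And>y. 0 \<le> f y" for f :: "'b \<Rightarrow> real"
  proof (rule has_bochner_integral_nn_integral)
    have fY: "f \<in> borel_measurable Y"
      using borel_measurable_integrable[OF f(1)[of "{}"]] setsK by (simp cong: measurable_cong_sets)
    then show "f \<in> borel_measurable ?L"
      using output_law_two_point(2)[OF M] by (simp cong: measurable_cong_sets)
    show "0 \<le> (\<Sum>S\<in>Pow {..<n}. bernoulli_weight q {..<n} S * (\<integral>y. f y \<partial>?K S))"
      using f q by (intro sum_nonneg mult_nonneg_nonneg bernoulli_weight_nonneg integral_nonneg_AE) auto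
    have "(\<integral>\<^sup>+y. ennreal (f y) \<partial>?L) =
        (\<Sum>S\<in>Pow {..<n}. ennreal (bernoulli_weight q {..<n} S) * (\<integral>\<^sup>+y. ennreal (f y) \<partial>?K S))"
      by (rule nn_integral_output_law_two_point[OF M q]) (use fY in measurable)
    also have "\<dots> = (\<Sum>S\<in>Pow {..<n}. ennreal (bernoulli_weight q {..<n} S * (\<integral>y. f y \<partial>?K S)))"
    proof (intro sum.cong refl)
      fix S assume "S \<in> Pow {..<n}"
      then have "(\<integral>\<^sup>+y. ennreal (f y) \<partial>?K S) = ennreal (\<integral>y. f y \<partial>?K S)"
        using f by (intro nn_integral_eq_integral) auto
      then show "ennreal (bernoulli_weight q {..<n} S) * (\<integral>\<^sup>+y. ennreal (f y) \<partial>?K S) =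
          ennreal (bernoulli_weight q {..<n} S * (\<integral>y. f y \<partial>?K S))"
        using f q by (simp add: ennreal_mult bernoulli_weight_nonneg integral_nonneg_AE)
    qed
    also have "\<dots> = ennreal (\<Sum>S\<in>Pow {..<n}. bernoulli_weight q {..<n} S * (\<integral>y. f y \<partial>?K S))"
      using f q by (intro sum_ennreal mult_nonneg_nonneg bernoulli_weight_nonneg integral_nonneg_AE) auto
    finally show "(\<integral>\<^sup>+y. ennreal (f y) \<partial>?L) = \<dots>" .
  qed (use f in auto)
  have "has_bochner_integral ?L (\<lambda>y. max 0 (h y) - max 0 (- h y))
     ((\<Sum>S\<in>Pow {..<n}. bernoulli_weight q {..<n} S * (\<integral>y. max 0 (h y) \<partial>?K S)) -
      (\<Sum>S\<in>Pow {..<n}. bernoulli_weight q {..<n} S * (\<integral>y. max 0 (- h y) \<partial>?K S)))"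
    by (intro has_bochner_integral_diff nonneg) (use h in auto)
  also have "(\<lambda>y. max 0 (h y) - max 0 (- h y)) = h"
    by auto
  also have "(\<Sum>S\<in>Pow {..<n}. bernoulli_weight q {..<n} S * (\<integral>y. max 0 (h y) \<partial>?K S)) -
      (\<Sum>S\<in>Pow {..<n}. bernoulli_weight q {..<n} S * (\<integral>y. max 0 (- h y) \<partial>?K S)) =
      (\<Sum>S\<in>Pow {..<n}. bernoulli_weight q {..<n} S * (\<integral>y. h y \<partial>?K S))"
    unfolding sum_subtractf[symmetric] right_diff_distrib[symmetric]
  proof (intro sum.cong refl arg_cong2[where f = "(*)"])
    fix S assume "S \<in> Pow {..<n}"
    then have "(\<integral>y. max 0 (h y) \<partial>?K S) - (\<integral>y. max 0 (- h y) \<partial>?K S) =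
        (\<integral>y. max 0 (h y) - max 0 (- h y) \<partial>?K S)"
      using h by (intro Bochner_Integration.integral_diff[symmetric]) auto
    also have "\<dots> = (\<integral>y. h y \<partial>?K S)"
      by (intro Bochner_Integration.integral_cong) auto
    finally show "(\<integral>y. max 0 (h y) \<partial>?K S) - (\<integral>y. max 0 (- h y) \<partial>?K S) = (\<integral>y. h y \<partial>?K S)" .
  qed
  finally show ?thesis
    by (rule has_bochner_integral_integral_eq)
qed

lemma measure_output_law_two_point:
  assumes M: "randomized_algorithm n borel Y M" and q: "0 \<le> q" "q \<le> 1" and A: "A \<in> sets Y"
  shows "measure (output_law n (two_point q v) M) A =
    (\<Sum>S\<in>Pow {..<n}. bernoulli_weight q {..<n} S * measure (M (corner {..<n} v S)) A)"
proof -
  have sets: "A \<in> sets (M (corner {..<n} v S))" for S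
    using A prob_space_kernel(2)[OF M corner_in_space] by simp
  have fin: "emeasure (M (corner {..<n} v S)) A < \<infinity>" for S
    using prob_space_kernel(1)[OF M corner_in_space, of v S]
    by (simp add: prob_space.finite_measure finite_measure.emeasure_eq_measure)
  have "(\<integral>y. indicator A y \<partial>output_law n (two_point q v) M) =
    (\<Sum>S\<in>Pow {..<n}. bernoulli_weight q {..<n} S * (\<integral>y. indicator A y \<partial>M (corner {..<n} v S)) :: real)"
    by (rule integral_output_law_two_point[OF M q]) (use sets fin in auto)
  then show ?thesis
    using A sets output_law_two_point(2)[OF M, of q v]
    by (simp add: sets.Int_space_eq2)
qed

text \<open>Every vertex of the cube has positive probability, so finite error on average means finite error at
each vertex.\<close>

lemma integrable_kernel_two_point:
  assumes M: "randomized_algorithm n borel borel M" and q: "0 < q" "q < 1"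
    and err: "(\<integral>\<^sup>+y. ennreal \<bar>y - m\<bar> \<partial>output_law n (two_point q v) M) \<le> ennreal \<alpha>"
    and S: "S \<subseteq> {..<n}"
  shows "integrable (M (corner {..<n} v S)) (\<lambda>y. y)"
proof -
  let ?K = "M (corner {..<n} v S)"
  interpret K: prob_space ?K by (rule prob_space_kernel(1)[OF M corner_in_space])
  have [measurable_cong]: "sets ?K = sets borel" by (rule prob_space_kernel(2)[OF M corner_in_space])
  have w: "0 < bernoulli_weight q {..<n} S" using q by (rule bernoulli_weight_pos)
  have "ennreal (bernoulli_weight q {..<n} S) * (\<integral>\<^sup>+y. ennreal \<bar>y - m\<bar> \<partial>?K) \<le>
    (\<integral>\<^sup>+y. ennreal \<bar>y - m\<bar> \<partial>output_law n (two_point q v) M)"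
    using q S by (subst nn_integral_output_law_two_point[OF M])
      (auto intro!: member_le_sum)
  also have "\<dots> < \<infinity>"
    using err by (simp add: le_less_trans)
  finally have "(\<integral>\<^sup>+y. ennreal \<bar>y - m\<bar> \<partial>?K) < \<infinity>"
    using w by (auto simp: ennreal_mult_less_top)
  then have "integrable ?K (\<lambda>y. y - m)"
    by (intro integrableI_bounded) auto
  then have "integrable ?K (\<lambda>y. (y - m) + m)"
    by (intro Bochner_Integration.integrable_add) auto
  then show ?thesis by simp
qed

text \<open>Jensen: \<open>p \<mapsto> min {\<delta>, p}\<close> is concave and the output law is the weighted mean of the
laws at the vertices.\<close>

lemma sum_truncated_tail_le:
  assumes M: "randomized_algorithm n borel Y M" and q: "0 \<le> q" "q \<le> 1"
    and h: "h \<in> borel_measurable Y" and "0 \<le> \<delta>"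
  shows "(\<Sum>S\<in>Pow {..<n}. ennreal (bernoulli_weight q {..<n} S) *
      truncated_tail \<delta> (M (corner {..<n} v S)) h)
    \<le> truncated_tail \<delta> (output_law n (two_point q v) M) h"
proof -
  let ?L = "output_law n (two_point q v) M" and ?K = "\<lambda>S. M (corner {..<n} v S)"
  let ?w = "bernoulli_weight q {..<n}"
  have setsK: "sets (?K S) = sets Y" and K: "prob_space (?K S)" for S
    by (rule prob_space_kernel[OF M corner_in_space])+
  have hK: "h \<in> borel_measurable (?K S)" for S
    using h setsK by (simp cong: measurable_cong_sets)
  have space: "space (?K S) = space Y" "space ?L = space Y" for S
    using sets_eq_imp_space_eq[OF setsK] sets_eq_imp_space_eq[OF output_law_two_point(2)[OF M]] by auto
  have w: "0 \<le> ?w S" for S using q by (rule bernoulli_weight_nonneg)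
  note [measurable] = borel_measurable_tail[OF K hK] h
  have "(\<Sum>S\<in>Pow {..<n}. ennreal (?w S) * truncated_tail \<delta> (?K S) h) =
    (\<integral>\<^sup>+x. (\<Sum>S\<in>Pow {..<n}. ennreal (?w S) *
      (ennreal (min \<delta> (measure (?K S) {y \<in> space (?K S). h y > x})) * indicator {0..} x)) \<partial>lborel)"
    unfolding truncated_tail_def
    by (subst nn_integral_sum, measurable, subst nn_integral_cmult, measurable)
  also have "\<dots> \<le> truncated_tail \<delta> ?L h"
    unfolding truncated_tail_def
  proof (intro nn_integral_mono)
    fix x :: real
    let ?A = "{y \<in> space Y. h y > x}"
    have "(\<Sum>S\<in>Pow {..<n}. ?w S * min \<delta> (measure (?K S) ?A)) \<le> (\<Sum>S\<in>Pow {..<n}. ?w S * \<delta>)"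
      using w by (intro sum_mono mult_left_mono) auto
    also have "\<dots> = \<delta>"
      by (simp add: sum_distrib_right[symmetric] sum_bernoulli_weight)
    finally have le1: "(\<Sum>S\<in>Pow {..<n}. ?w S * min \<delta> (measure (?K S) ?A)) \<le> \<delta>" .
    have "(\<Sum>S\<in>Pow {..<n}. ?w S * min \<delta> (measure (?K S) ?A)) \<le> (\<Sum>S\<in>Pow {..<n}. ?w S * measure (?K S) ?A)"
      using w by (intro sum_mono mult_left_mono) auto
    also have "\<dots> = measure ?L ?A"
      by (rule measure_output_law_two_point[OF M q, symmetric]) measurable
    finally have "ennreal (\<Sum>S\<in>Pow {..<n}. ?w S * min \<delta> (measure (?K S) ?A)) \<le> ennreal (min \<delta> (measure ?L ?A))"
      using le1 by (intro ennreal_leI) simp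
    also have "ennreal (\<Sum>S\<in>Pow {..<n}. ?w S * min \<delta> (measure (?K S) ?A)) =
        (\<Sum>S\<in>Pow {..<n}. ennreal (?w S) * ennreal (min \<delta> (measure (?K S) ?A)))"
      using w \<open>0 \<le> \<delta>\<close> by (simp add: sum_ennreal[symmetric] ennreal_mult)
    finally show "(\<Sum>S\<in>Pow {..<n}. ennreal (?w S) *
      (ennreal (min \<delta> (measure (?K S) {y \<in> space (?K S). h y > x})) * indicator {0..} x))
      \<le> ennreal (min \<delta> (measure ?L {y \<in> space ?L. h y > x})) * indicator {0..} x"
      unfolding space by (auto simp: indicator_def)
  qed
  finally show ?thesis .
qed

lemma neighbouring_corner:
  assumes "i < n" "i \<notin> T" "v \<noteq> 0"
  shows "neighbouring n (corner {..<n} v (insert i T)) (corner {..<n} v T)"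
    "neighbouring n (corner {..<n} v T) (corner {..<n} v (insert i T))"
  using assms unfolding neighbouring_def corner_def by (auto intro!: ex1I[of _ i] split: if_splits)

section \<open>The influence of one sample\<close>

text \<open>The left-hand side is the expected change of the output mean when sample \<open>i\<close> is switched from
\<open>0\<close> to \<open>v\<close>. In the gap bound the main term belongs to the value \<open>0\<close>, of probability
\<open>1 - q \<ge> 1/2\<close>; the tail terms are paired with weights \<open>q\<close> and \<open>1 - q\<close>, both at least
\<open>q\<close>. Undoing the conditioning on sample \<open>i\<close> turns these averages into the error and the tail
integral of the output law.\<close>

lemma sensitivity_le:
  fixes M :: "(nat \<Rightarrow> real) \<Rightarrow> real measure" and \<epsilon> \<delta> \<alpha> \<eta> m q v :: real
  assumes M: "randomized_algorithm n borel borel M"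
    and dp: "differentially_private \<epsilon> \<delta> n borel borel M"
    and "0 \<le> \<epsilon>" "0 \<le> \<delta>" "0 \<le> \<alpha>" "0 \<le> \<eta>" "v \<noteq> 0" and q: "0 < q" "q \<le> 1 / 2" and "i < n"
    and err: "(\<integral>\<^sup>+y. ennreal \<bar>y - m\<bar> \<partial>output_law n (two_point q v) M) \<le> ennreal \<alpha>"
    and tail: "truncated_tail \<delta> (output_law n (two_point q v) M) (\<lambda>y. \<bar>y - m\<bar>) \<le> ennreal \<eta>"
  defines "F \<equiv> \<lambda>S. \<integral>y. y \<partial>M (corner {..<n} v S)"
  shows "(\<Sum>T\<in>Pow ({..<n} - {i}). bernoulli_weight q ({..<n} - {i}) T * (F (insert i T) - F T))
    \<le> 4 * sinh \<epsilon> * \<alpha> + \<eta> / q"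
proof -
  let ?L = "output_law n (two_point q v) M" and ?K = "\<lambda>S. M (corner {..<n} v S)"
  let ?A = "{..<n} - {i}"
  let ?w = "bernoulli_weight q {..<n}" and ?u = "bernoulli_weight q ?A"
  define a where "a S = (\<integral>y. \<bar>y - m\<bar> \<partial>?K S)" for S
  define J where "J S = enn2real (truncated_tail \<delta> (?K S) (\<lambda>y. \<bar>y - m\<bar>))" for S
  have K: "prob_space (?K S)" "sets (?K S) = sets borel" for S
    by (rule prob_space_kernel[OF M corner_in_space])+
  have int: "integrable (?K S) (\<lambda>y. y)" if "S \<subseteq> {..<n}" for S
    by (rule integrable_kernel_two_point[OF M _ _ err that]) (use q in auto)
  have int_abs: "integrable (?K S) (\<lambda>y. \<bar>y - m\<bar>)" if "S \<subseteq> {..<n}" for S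
  proof -
    interpret prob_space "?K S" by (rule K)
    show ?thesis using int[OF that] by auto
  qed
  have I: "{..<n} = insert i ?A" "finite ?A" "i \<notin> ?A" using \<open>i < n\<close> by auto
  have w: "0 \<le> ?w S" "0 \<le> ?u S" for S using q by (auto intro!: bernoulli_weight_nonneg)
  have a0: "0 \<le> a S" and J0: "0 \<le> J S" for S
    by (auto simp: a_def J_def intro!: integral_nonneg_AE)

  have "ennreal (\<Sum>S\<in>Pow {..<n}. ?w S * a S) = (\<Sum>S\<in>Pow {..<n}. ennreal (?w S * a S))"
    using w a0 by (intro sum_ennreal[symmetric]) auto
  also have "\<dots> = (\<Sum>S\<in>Pow {..<n}. ennreal (?w S) * (\<integral>\<^sup>+y. ennreal \<bar>y - m\<bar> \<partial>?K S))"
  proof (intro sum.cong refl)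
    fix S assume "S \<in> Pow {..<n}"
    then have "(\<integral>\<^sup>+y. ennreal \<bar>y - m\<bar> \<partial>?K S) = ennreal (a S)"
      unfolding a_def using int_abs by (intro nn_integral_eq_integral) auto
    then show "ennreal (?w S * a S) = ennreal (?w S) * (\<integral>\<^sup>+y. ennreal \<bar>y - m\<bar> \<partial>?K S)"
      using w by (simp add: ennreal_mult a0)
  qed
  also have "\<dots> \<le> ennreal \<alpha>"
    using err q by (subst (asm) nn_integral_output_law_two_point[OF M]) auto
  finally have sum_a: "(\<Sum>S\<in>Pow {..<n}. ?w S * a S) \<le> \<alpha>"
    using \<open>0 \<le> \<alpha>\<close> by (simp add: ennreal_le_iff)

  have "ennreal (\<Sum>S\<in>Pow {..<n}. ?w S * J S) = (\<Sum>S\<in>Pow {..<n}. ennreal (?w S * J S))"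
    using w J0 by (intro sum_ennreal[symmetric]) auto
  also have "\<dots> = (\<Sum>S\<in>Pow {..<n}. ennreal (?w S) * truncated_tail \<delta> (?K S) (\<lambda>y. \<bar>y - m\<bar>))"
  proof (intro sum.cong refl)
    fix S assume "S \<in> Pow {..<n}"
    then have "truncated_tail \<delta> (?K S) (\<lambda>y. \<bar>y - m\<bar>) \<le> ennreal (a S)"
      unfolding a_def using int_abs by (intro truncated_tail_le K) auto
    then have "truncated_tail \<delta> (?K S) (\<lambda>y. \<bar>y - m\<bar>) = ennreal (J S)"
      unfolding J_def by (metis ennreal_enn2real ennreal_less_top le_less_trans)
    then show "ennreal (?w S * J S) = ennreal (?w S) * truncated_tail \<delta> (?K S) (\<lambda>y. \<bar>y - m\<bar>)"
      using w by (simp add: ennreal_mult J0)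
  qed
  also have "\<dots> \<le> truncated_tail \<delta> ?L (\<lambda>y. \<bar>y - m\<bar>)"
    using q \<open>0 \<le> \<delta>\<close> by (intro sum_truncated_tail_le[OF M]) auto
  also note tail
  finally have sum_J: "(\<Sum>S\<in>Pow {..<n}. ?w S * J S) \<le> \<eta>"
    using \<open>0 \<le> \<eta>\<close> by (simp add: ennreal_le_iff)

  have gap: "F (insert i T) - F T \<le> 2 * sinh \<epsilon> * a T + J (insert i T) + J T" if "T \<subseteq> ?A" for T
    unfolding F_def a_def J_def
  proof (rule dp_expectation_gap)
    have T: "T \<subseteq> {..<n}" "insert i T \<subseteq> {..<n}" "i \<notin> T" using that \<open>i < n\<close> by auto
    note nb = neighbouring_corner[OF \<open>i < n\<close> T(3) \<open>v \<noteq> 0\<close>]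
    show "measure (?K (insert i T)) Y \<le> exp \<epsilon> * measure (?K T) Y + \<delta>"
      "measure (?K T) Y \<le> exp \<epsilon> * measure (?K (insert i T)) Y + \<delta>"
      if "Y \<in> sets borel" for Y
      using dp nb that corner_in_space unfolding differentially_private_def by blast+
    show "integrable (?K (insert i T)) (\<lambda>y. y)" "integrable (?K T) (\<lambda>y. y)"
      using T by (auto intro: int)
  qed (use K \<open>i < n\<close> \<open>0 \<le> \<epsilon>\<close> \<open>0 \<le> \<delta>\<close> in auto)

  have "(1 - q) * (\<Sum>T\<in>Pow ?A. ?u T * a T) \<le> (\<Sum>T\<in>Pow ?A. ?u T * (q * a (insert i T) + (1 - q) * a T))"
    unfolding sum_distrib_left using w a0 q
    by (intro sum_mono) (auto simp: algebra_simps intro!: mult_left_mono)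
  also have "\<dots> \<le> \<alpha>"
    using sum_a unfolding sum_bernoulli_weight_insert[OF I(2,3), symmetric] I(1)[symmetric] .
  finally have "(1 - q) * (\<Sum>T\<in>Pow ?A. ?u T * a T) \<le> \<alpha>" .
  moreover have "1 / 2 * (\<Sum>T\<in>Pow ?A. ?u T * a T) \<le> (1 - q) * (\<Sum>T\<in>Pow ?A. ?u T * a T)"
    using q w a0 by (intro mult_right_mono sum_nonneg) auto
  ultimately have bound_a: "(\<Sum>T\<in>Pow ?A. ?u T * a T) \<le> 2 * \<alpha>" by simp

  have "q * (\<Sum>T\<in>Pow ?A. ?u T * (J (insert i T) + J T)) \<le>
      (\<Sum>T\<in>Pow ?A. ?u T * (q * J (insert i T) + (1 - q) * J T))"
    unfolding sum_distrib_left
  proof (intro sum_mono)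
    fix T
    have "q * J T \<le> (1 - q) * J T" using q J0 by (intro mult_right_mono) auto
    then have "?u T * (q * J (insert i T) + q * J T) \<le> ?u T * (q * J (insert i T) + (1 - q) * J T)"
      using w by (intro mult_left_mono) auto
    then show "q * (?u T * (J (insert i T) + J T)) \<le> ?u T * (q * J (insert i T) + (1 - q) * J T)"
      by (simp add: algebra_simps)
  qed
  also have "\<dots> \<le> \<eta>"
    using sum_J unfolding sum_bernoulli_weight_insert[OF I(2,3), symmetric] I(1)[symmetric] .
  finally have bound_J: "(\<Sum>T\<in>Pow ?A. ?u T * (J (insert i T) + J T)) \<le> \<eta> / q"
    using q by (simp add: field_simps)

  have "(\<Sum>T\<in>Pow ?A. ?u T * (F (insert i T) - F T)) \<le>
      (\<Sum>T\<in>Pow ?A. ?u T * (2 * sinh \<epsilon> * a T + J (insert i T) + J T))"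
    using w gap by (intro sum_mono mult_left_mono) auto
  also have "\<dots> = 2 * sinh \<epsilon> * (\<Sum>T\<in>Pow ?A. ?u T * a T) + (\<Sum>T\<in>Pow ?A. ?u T * (J (insert i T) + J T))"
    by (simp add: sum_distrib_left sum.distrib[symmetric] algebra_simps)
  also have "\<dots> \<le> 2 * sinh \<epsilon> * (2 * \<alpha>) + \<eta> / q"
    using bound_a bound_J \<open>0 \<le> \<epsilon>\<close> by (intro add_mono mult_left_mono) auto
  finally show ?thesis by simp
qed

section \<open>The lower bound on the error\<close>

text \<open>The centred moment is \<open>q (v - q v)\<^sup>\<lambda> + (1 - q) (q v)\<^sup>\<lambda>\<close>. Each term is at most
\<open>q v\<^sup>\<lambda>\<close>, the second because \<open>q\<^sup>\<lambda> \<le> q\<close>.\<close>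

lemma admissible_two_point:
  fixes q v lam :: real
  assumes "0 \<le> q" "q \<le> 1" "0 \<le> v" "1 \<le> lam" "q * v \<le> 1" "2 * q * v powr lam \<le> 1"
  shows "admissible lam (two_point q v)"
proof -
  have m: "mean (two_point q v) = q * v" using assms by (intro mean_two_point)
  have "\<bar>v - q * v\<bar> powr lam \<le> v powr lam"
    using assms by (intro powr_mono2) (auto simp: mult_left_le_one_le)
  then have hi: "q * (\<bar>v - q * v\<bar> powr lam) \<le> q * v powr lam"
    using assms by (intro mult_left_mono)
  have "\<bar>0 - q * v\<bar> powr lam = q powr lam * v powr lam"
    using assms by (simp add: powr_mult)
  also have "\<dots> \<le> q * v powr lam"
    using assms powr_mono'[of 1 lam q] by (intro mult_right_mono) auto
  finally have "(1 - q) * (\<bar>0 - q * v\<bar> powr lam) \<le> 1 * (q * v powr lam)"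
    using assms by (intro mult_mono) auto
  with hi have "q * (\<bar>v - q * v\<bar> powr lam) + (1 - q) * (\<bar>0 - q * v\<bar> powr lam) \<le> 1"
    using assms(6) by simp
  moreover have "(\<integral>\<^sup>+x. ennreal (\<bar>x - q * v\<bar> powr lam) \<partial>two_point q v) =
      ennreal (q * (\<bar>v - q * v\<bar> powr lam) + (1 - q) * (\<bar>0 - q * v\<bar> powr lam))"
    using assms by (subst nn_integral_two_point) (auto simp: ennreal_mult ennreal_plus)
  ultimately have "(\<integral>\<^sup>+x. ennreal (\<bar>x - q * v\<bar> powr lam) \<partial>two_point q v) \<le> 1"
    by (simp add: ennreal_le_1)
  then show ?thesis
    using assms real_distribution_two_point
    by (auto simp: admissible_def m intro!: integrable_two_point)
qed

theorem theorem2p1: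
  fixes \<epsilon> \<delta> \<beta> \<alpha> \<tau> lam \<gamma> :: real and n :: nat
    and M :: "(nat \<Rightarrow> real) \<Rightarrow> real measure"
  assumes "\<epsilon> \<ge> 0" and "\<delta> \<ge> 0" and "\<beta> \<ge> 0" and "\<alpha> \<ge> 0" and "\<tau> \<ge> 0"
    and "lam > 1" and "n \<ge> 1"
    and "randomized_algorithm n borel borel M"
    and "differentially_private \<epsilon> \<delta> n borel borel M"
    and bias: "\<And>P. admissible lam P \<Longrightarrow> \<bar>(\<integral>y. y \<partial>output_law n P M) - mean P\<bar> \<le> \<beta>"
    and error: "\<And>P. admissible lam P \<Longrightarrow>
      (\<integral>\<^sup>+y. ennreal \<bar>y - mean P\<bar> \<partial>output_law n P M) \<le> ennreal \<alpha>"
    and tail: "\<And>P. admissible lam P \<Longrightarrow>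
      (\<integral>\<^sup>+x\<in>{0..}. ennreal (min \<delta> (\<P>(y in output_law n P M. \<bar>y - mean P\<bar> > x))) \<partial>lborel)
        \<le> ennreal (\<alpha> * \<tau>)"
    and "\<gamma> > 0" and "16 * \<beta> \<le> \<gamma>" and "\<gamma> \<le> 1 / 5"
  shows "ereal \<alpha> \<ge>
    inverse (ereal (32 * real n * sinh \<epsilon> * \<gamma> powr (1 / (lam - 1)) + 16 * real n * \<tau> * inverse \<gamma>))"
proof -
  note M = \<open>randomized_algorithm n borel borel M\<close>
  \<comment> \<open>The moment condition \<open>2 q v\<^sup>\<lambda> \<le> 1\<close> at the largest mean \<open>q v = \<gamma>/2\<close> reads
    \<open>\<gamma> v\<^sup>\<lambda>\<^sup>-\<^sup>1 \<le> 1\<close>, and this is the largest \<open>v\<close> that satisfies it.\<close>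
  define v where "v = inverse (\<gamma> powr (1 / (lam - 1)))"
  define q0 q1 where "q0 = \<gamma> / (4 * v)" and "q1 = \<gamma> / (2 * v)"
  have "\<gamma> powr (1 / (lam - 1)) \<le> 1"
    using \<open>\<gamma> > 0\<close> \<open>\<gamma> \<le> 1 / 5\<close> \<open>lam > 1\<close> by (intro powr_le1) auto
  then have "v \<ge> 1"
    using \<open>\<gamma> > 0\<close> by (simp add: v_def one_le_inverse_iff)
  have v_powr: "v powr lam = v / \<gamma>"
  proof -
    have "v powr (lam - 1) = inverse \<gamma>"
      unfolding v_def powr_minus[symmetric] powr_powr
      using \<open>\<gamma> > 0\<close> \<open>lam > 1\<close> by (simp add: powr_minus)
    then show ?thesis
      using \<open>v \<ge> 1\<close> powr_add[of v "lam - 1" 1] by (simp add: field_simps)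
  qed
  have q: "0 < q0" "q0 < q1" "q1 \<le> 1 / 10"
  proof -
    show "0 < q0" "q0 < q1" using \<open>\<gamma> > 0\<close> \<open>v \<ge> 1\<close> by (auto simp: q0_def q1_def field_simps)
    have "q1 \<le> \<gamma> / 2"
      using \<open>\<gamma> > 0\<close> \<open>v \<ge> 1\<close> unfolding q1_def by (intro divide_left_mono) auto
    then show "q1 \<le> 1 / 10" using \<open>\<gamma> \<le> 1 / 5\<close> by simp
  qed
  have adm: "admissible lam (two_point q v)" and mean: "mean (two_point q v) = q * v"
    if "q0 \<le> q" "q \<le> q1" for q
  proof -
    have qv: "q * v \<le> \<gamma> / 2"
      using that \<open>v \<ge> 1\<close> by (simp add: q1_def field_simps)
    have "2 * q * v powr lam = 2 * (q * v) / \<gamma>" by (simp add: v_powr)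
    also have "\<dots> \<le> 1" using qv \<open>\<gamma> > 0\<close> by (simp add: field_simps)
    finally show "admissible lam (two_point q v)"
      using that q qv \<open>v \<ge> 1\<close> \<open>lam > 1\<close> \<open>\<gamma> \<le> 1 / 5\<close> by (intro admissible_two_point) auto
    show "mean (two_point q v) = q * v"
      using that q by (intro mean_two_point) auto
  qed

  define F where "F S = (\<integral>y. y \<partial>M (corner {..<n} v S))" for S
  define g where "g q = (\<Sum>S\<in>Pow {..<n}. bernoulli_weight q {..<n} S * F S)" for q
  define g' where "g' q = (\<Sum>i<n. \<Sum>T\<in>Pow ({..<n} - {i}).
      bernoulli_weight q ({..<n} - {i}) T * (F (insert i T) - F T))" for q
  have near_mean: "\<bar>g q - q * v\<bar> \<le> \<beta>" if "q0 \<le> q" "q \<le> q1" for q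
  proof -
    have "(\<integral>y. y \<partial>output_law n (two_point q v) M) = g q"
      unfolding g_def F_def using that q
      by (intro integral_output_law_two_point[OF M] integrable_kernel_two_point[OF M _ _ error[OF adm[OF that]]])
        auto
    then show ?thesis using bias[OF adm[OF that]] mean[OF that] by simp
  qed
  have deriv: "(g has_real_derivative g' q) (at q)" for q
    unfolding g_def g'_def by (rule DERIV_sum_bernoulli_weight) simp
  obtain q where q': "q0 < q" "q < q1" "g q1 - g q0 = (q1 - q0) * g' q"
    using MVT2[OF q(2) deriv] by auto

  have "g' q \<le> (\<Sum>i<n. 4 * sinh \<epsilon> * \<alpha> + \<alpha> * \<tau> / q)"
    unfolding g'_def F_def
  proof (intro sum_mono sensitivity_le[OF M])
    have 1: "q0 \<le> q" "q \<le> q1" using q' by auto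
    show "(\<integral>\<^sup>+y. ennreal \<bar>y - mean (two_point q v)\<bar> \<partial>output_law n (two_point q v) M) \<le> ennreal \<alpha>"
      by (rule error[OF adm[OF 1]])
    show "truncated_tail \<delta> (output_law n (two_point q v) M) (\<lambda>y. \<bar>y - mean (two_point q v)\<bar>)
        \<le> ennreal (\<alpha> * \<tau>)"
      unfolding truncated_tail_def by (rule tail[OF adm[OF 1]])
  qed (use assms q q' \<open>v \<ge> 1\<close> in auto)
  also have "\<dots> \<le> (\<Sum>i<n. 4 * sinh \<epsilon> * \<alpha> + \<alpha> * \<tau> / q0)"
    using q q' \<open>\<alpha> \<ge> 0\<close> \<open>\<tau> \<ge> 0\<close> by (intro sum_mono add_left_mono divide_left_mono) auto
  finally have upper: "g' q \<le> n * \<alpha> * (4 * sinh \<epsilon> + 4 * v * \<tau> / \<gamma>)"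
    by (simp add: q0_def algebra_simps)

  \<comment> \<open>Of the shift \<open>\<gamma>/4\<close> of the mean, the bias at the two ends can hide at most
    \<open>2 \<beta> \<le> \<gamma>/8\<close>.\<close>
  have "(q1 - q0) * (v / 2) = \<gamma> / 4 - \<gamma> / 8"
    using \<open>v \<ge> 1\<close> by (simp add: q0_def q1_def field_simps)
  also have "\<dots> \<le> (q1 * v - q0 * v) - 2 * \<beta>"
    using \<open>v \<ge> 1\<close> \<open>16 * \<beta> \<le> \<gamma>\<close> by (simp add: q0_def q1_def)
  also have "\<dots> \<le> (q1 - q0) * g' q"
    using near_mean[of q0] near_mean[of q1] q q'(3) by linarith
  finally have "v / 2 \<le> g' q"
    using q by simp
  then have "v / 2 \<le> n * \<alpha> * (4 * sinh \<epsilon> + 4 * v * \<tau> / \<gamma>)"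
    using upper by linarith
  then have "2 / v * (v / 2) \<le> 2 / v * (n * \<alpha> * (4 * sinh \<epsilon> + 4 * v * \<tau> / \<gamma>))"
    using \<open>v \<ge> 1\<close> by (intro mult_left_mono) auto
  also have "\<dots> = \<alpha> * (8 * n * sinh \<epsilon> * inverse v + 8 * n * \<tau> * inverse \<gamma>)"
    using \<open>v \<ge> 1\<close> \<open>\<gamma> > 0\<close> by (simp add: field_simps)
  also have "2 / v * (v / 2) = 1" using \<open>v \<ge> 1\<close> by simp
  also have "\<alpha> * (8 * n * sinh \<epsilon> * inverse v + 8 * n * \<tau> * inverse \<gamma>) \<le>
      \<alpha> * (32 * n * sinh \<epsilon> * inverse v + 16 * n * \<tau> * inverse \<gamma>)"
    using assms \<open>v \<ge> 1\<close> by (intro mult_left_mono add_mono mult_right_mono) auto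
  also have "inverse v = \<gamma> powr (1 / (lam - 1))" by (simp add: v_def)
  finally have key: "1 \<le> \<alpha> * (32 * n * sinh \<epsilon> * \<gamma> powr (1 / (lam - 1)) + 16 * n * \<tau> * inverse \<gamma>)"
    (is "1 \<le> \<alpha> * ?D") .
  \<comment> \<open>A vanishing denominator would contradict \<open>key\<close>; in that case no such \<open>M\<close> exists.\<close>
  have "0 \<le> ?D" using assms by (intro add_nonneg_nonneg mult_nonneg_nonneg) auto
  with key have "0 < ?D" by (cases "?D = 0") auto
  then have "inverse (ereal ?D) = ereal (inverse ?D)" by simp
  moreover have "inverse ?D \<le> \<alpha>"
    using key \<open>0 < ?D\<close> by (simp only: inverse_eq_divide pos_divide_le_eq)
  ultimately show ?thesis by simp
qed

end
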